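(* An action operad $\Lambda$ determines, and is uniquely determined by, the following: - groups $\Lambda(n)$ together with group homomorphisms $\pi_n:\Lambda(n)\to\Sigma_n$; - a group homomorphism $\beta:\Lambda(k_1)\times\cdots\times\Lambda(k_n)\to\Lambda(k_1+\cdots+k_n)$ for each $n>0$ and $k_1,\dots,k_n$; - a function of sets $\delta_{n;k_1,\dots,k_n}:\Lambda(n)\to\Lambda(k_1+\cdots+k_n)$ for each $n,k_1,\dots,k_n$; subject to the axioms below. Here $f,g,h$, with or without subscripts, always denote elements of some group $\Lambda(n)$; $j,k,m,n,p$ are natural numbers; and $i$ is a natural number between $1$ and $n$. (1) The homomorphisms $\beta$ are natural with respect to the maps $\pi_n$: $\pi(\beta(g_1,\dots,g_n))=\beta^{\Sigma}(\pi(g_1),\dots,\pi(g_n))$. (2) The homomorphism $\beta:\Lambda(k)\to\Lambda(k)$ (the case $n=1$) is the identity. (3) The homomorphisms $\beta$ are associative: $\beta(\underline{h_1},\dots,\underline{h_n})=\beta(\beta(\underline{h_1}),\dots,\beta(\underline{h_n}))$, where $\underline{h_i}=h_{i1},\dots,h_{ij_i}$. (4) The functions $\delta_{n;k_1,\dots,k_n}$ are natural with respect to the maps $\pi_n$: $\pi(\delta_{n;k_1,\dots,k_n}(g))=\delta^{\Sigma}_{n;k_1,\dots,k_n}(\pi(g))$. (5) The function $\delta_{n;1,\dots,1}:\Lambda(n)\to\Lambda(n)$ is the identity, and $\delta_{n;k_1,\dots,k_n}$ maps $e_n$ to $e_{k_1+\cdots+k_n}$. (6) $\delta_{n;k_1,\dots,k_n}(g)\,\delta_{n;j_1,\dots,j_n}(h)=\delta_{n;j_1,\dots,j_n}(gh)$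 holds when $k_i=j_{h^{-1}(i)}$. (7) The functions $\delta$ are associative: $\delta_{m_1+\cdots+m_n;\underline{p_1},\dots,\underline{p_n}}\big(\delta_{n;m_1,\dots,m_n}(g)\big)=\delta_{n;P_1,\dots,P_n}(g)$, where $P_i=p_{i1}+\cdots+p_{im_i}$ and $\underline{p_i}=p_{i1},\dots,p_{im_i}$; when $m_i=0$, the list $\underline{p_i}$ is empty and $P_i$ is defined to be $0$. (8) $\delta_{n;k_1,\dots,k_n}(g)\,\beta(h_1,\dots,h_n)=\beta(h_{g^{-1}(1)},\dots,h_{g^{-1}(n)})\,\delta_{n;k_1,\dots,k_n}(g)$ holds, where $h_i\in\Lambda(k_i)$. (9) $\beta(\delta_1(g_1),\dots,\delta_n(g_n))=\delta_c(\beta(g_1,\dots,g_n))$ holds, where $\delta_i(g_i)$ is shorthand for $\delta_{k_i;m_{i1},\dots,m_{ik_i}}(g_i)$ and $\delta_c$ is shorthand for $\delta_{k_1+\cdots+k_n;m_{11},m_{12},\dots,m_{1k_1},m_{21},\dots,m_{nk_n}}$.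
   Context: Natural numbers include $0$; $\Sigma_n$ is the symmetric group on $1,\dots,n$; $e_n$ is the identity element of $\Lambda(n)$; permutations compose as functions. For $g\in\Lambda(n)$, $g(i)$ means $\pi_n(g)(i)$ and $g^{-1}(i)$ means $\pi_n(g)^{-1}(i)$. A (non-symmetric) operad $O$ in sets consists of sets $O(n)$ ($n\in\mathbb N$), an element $\mathrm{id}\in O(1)$, and functions $\mu:O(n)\times O(k_1)\times\cdots\times O(k_n)\to O(k_1+\cdots+k_n)$ such that $\mu(\mathrm{id};x)=x=\mu(x;\mathrm{id},\dots,\mathrm{id})$ and $\mu(\mu(x;y_1,\dots,y_n);z_{11},\dots,z_{nk_n})=\mu(x;\mu(y_1;z_{11},\dots,z_{1k_1}),\dots,\mu(y_n;z_{n1},\dots,z_{nk_n}))$. Maps of operads preserve $\mathrm{id}$ and $\mu$. For permutations, $\beta^{\Sigma}(\tau_1,\dots,\tau_n)\in\Sigma_{k_1+\cdots+k_n}$ is the block sum of the $\tau_i\in\Sigma_{k_i}$ (the $i$th consecutive block, of size $k_i$, is permuted by $\tau_i$). For $\sigma\in\Sigma_n$, $\delta^{\Sigma}_{n;k_1,\dots,k_n}(\sigma)$ is the permutation sending $k_1+\cdots+k_{i-1}+a$ (with $1\le a\le k_i$) to $\big(\sum_{i':\sigma(i')<\sigma(i)}k_{i'}\big)+a$. The operad $\Sigma$ has $\Sigma(n)=\Sigma_n$, identity $e_1$, and $\mu(\sigma;\tau_1,\dots,\tau_n)=\delta^{\Sigma}_{n;k_1,\dots,k_n}(\sigma)\cdot\beta^{\Sigma}(\tau_1,\dots,\tau_n)$.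 An action operad $(\Lambda,\pi)$ is an operad $\Lambda$ in sets with a group structure on each $\Lambda(n)$, together with a map of operads $\pi:\Lambda\to\Sigma$ each of whose components $\pi_n:\Lambda(n)\to\Sigma_n$ is a group homomorphism, such that $$\mu(g';f_1',\dots,f_n')\,\mu(g;f_1,\dots,f_n)=\mu(g'g;f'_{g(1)}f_1,\dots,f'_{g(n)}f_n)$$ in the group $\Lambda(k_1+\cdots+k_n)$, for $g,g'\in\Lambda(n)$, $f_i\in\Lambda(k_i)$, $f'_i\in\Lambda(k_{g^{-1}(i)})$. *)

theory Defs
  imports "HOL-Algebra.Sym_Groups" "HOL-Algebra.Weak_Morphisms"
begin

text \<open>
  Conventions. A tuple of arities \<open>k\<^sub>1, \<dots>, k\<^sub>n\<close> is a list \<open>ks\<close> of length \<open>n\<close>; lists are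
  0-indexed, whereas permutations act on \<open>{1..n}\<close>, so \<open>k\<^sub>i\<close> is \<open>ks ! (i - 1)\<close>. A family of
  functions depending on \<open>n; k\<^sub>1, \<dots>, k\<^sub>n\<close> takes \<open>ks\<close> as its first argument, \<open>n\<close> being
  \<open>length ks\<close>. The sets \<open>O(n)\<close> are subsets of one type (not assumed disjoint), and functions
  are extensional, so that equality of functions means equality on their domains. The group
  \<open>\<Lambda>(n)\<close> is \<open>G n\<close>, with identity element \<open>e\<^sub>n\<close>.
\<close>

locale operad =
  fixes X :: "nat \<Rightarrow> 'a set"
    and u :: 'a
    and \<mu> :: "nat list \<Rightarrow> 'a \<times> 'a list \<Rightarrow> 'a"
  assumes unit_closed: "u \<in> X 1"
    and comp_closed: "\<mu> ks \<in> X (length ks) \<times> listset (map X ks) \<rightarrow>\<^sub>E X (sum_list ks)"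
    and left_unit: "x \<in> X n \<Longrightarrow> \<mu> [n] (u, [x]) = x"
    and right_unit: "x \<in> X n \<Longrightarrow> \<mu> (replicate n 1) (x, replicate n u) = x"
    and assoc:
      "\<lbrakk> x \<in> X (length mss);
         ys \<in> listset (map X (map length mss));
         zss \<in> listset (map (\<lambda>ms. listset (map X ms)) mss) \<rbrakk> \<Longrightarrow>
       \<mu> (concat mss) (\<mu> (map length mss) (x, ys), concat zss)
         = \<mu> (map sum_list mss) (x, map2 \<mu> mss (zip ys zss))"

definition operad_map ::
  "(nat \<Rightarrow> 'a set) \<Rightarrow> 'a \<Rightarrow> (nat list \<Rightarrow> 'a \<times> 'a list \<Rightarrow> 'a) \<Rightarrow>
   (nat \<Rightarrow> 'b set) \<Rightarrow> 'b \<Rightarrow> (nat list \<Rightarrow> 'b \<times> 'b list \<Rightarrow> 'b) \<Rightarrow>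
   (nat \<Rightarrow> 'a \<Rightarrow> 'b) \<Rightarrow> bool" where
  "operad_map X u \<mu> Y v \<nu> \<phi> \<longleftrightarrow>
     (\<forall>n. \<phi> n \<in> X n \<rightarrow> Y n) \<and>
     \<phi> 1 u = v \<and>
     (\<forall>ks x ys. x \<in> X (length ks) \<longrightarrow> ys \<in> listset (map X ks) \<longrightarrow>
        \<phi> (sum_list ks) (\<mu> ks (x, ys)) = \<nu> ks (\<phi> (length ks) x, map2 \<phi> ks ys))"

text \<open>For \<open>1 \<le> x \<le> k\<^sub>1 + \<dots> + k\<^sub>n\<close>, the index \<open>i\<close> (counted from 1) of the block containing \<open>x\<close>.\<close>

definition block :: "nat list \<Rightarrow> nat \<Rightarrow> nat" where
  "block ks x = (LEAST i. x \<le> sum_list (take i ks))"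

definition sym_beta :: "nat list \<Rightarrow> (nat \<Rightarrow> nat) list \<Rightarrow> nat \<Rightarrow> nat" where
  "sym_beta ks \<tau>s x =
     (if x \<in> {1..sum_list ks} then
        let i = block ks x; s = sum_list (take (i - 1) ks) in s + (\<tau>s ! (i - 1)) (x - s)
      else x)"

definition sym_delta :: "nat list \<Rightarrow> (nat \<Rightarrow> nat) \<Rightarrow> nat \<Rightarrow> nat" where
  "sym_delta ks \<sigma> x =
     (if x \<in> {1..sum_list ks} then
        let i = block ks x; s = sum_list (take (i - 1) ks) in
          (\<Sum>i' | i' \<in> {1..length ks} \<and> \<sigma> i' < \<sigma> i. ks ! (i' - 1)) + (x - s)
      else x)"

definition sym_comp :: "nat list \<Rightarrow> (nat \<Rightarrow> nat) \<times> (nat \<Rightarrow> nat) list \<Rightarrow> nat \<Rightarrow> nat" where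
  "sym_comp ks =
     (\<lambda>(\<sigma>, \<tau>s) \<in> carrier (sym_group (length ks)) \<times> listset (map (\<lambda>k. carrier (sym_group k)) ks).
        sym_delta ks \<sigma> \<otimes>\<^bsub>sym_group (sum_list ks)\<^esub> sym_beta ks \<tau>s)"

lemma block_eq:
  assumes "1 \<le> i" "i \<le> length ks" "1 \<le> a" "a \<le> ks ! (i - 1)"
  shows "block ks (sum_list (take (i - 1) ks) + a) = i"
proof -
  have step: "sum_list (take i ks) = sum_list (take (i - 1) ks) + ks ! (i - 1)"
    using assms by (cases i) (auto simp: take_Suc_conv_app_nth)
  have mono: "sum_list (take j ks) \<le> sum_list (take (i - 1) ks)" if "j \<le> i - 1" for j
  proof -
    have "take (i - 1) ks = take j ks @ take (i - 1 - j) (drop j ks)"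
      using that by (metis le_add_diff_inverse take_add)
    then show ?thesis by simp
  qed
  show ?thesis unfolding block_def
  proof (rule Least_equality)
    show "sum_list (take (i - 1) ks) + a \<le> sum_list (take i ks)"
      using assms step by simp
  next
    fix j assume "sum_list (take (i - 1) ks) + a \<le> sum_list (take j ks)"
    then show "i \<le> j" using mono[of j] assms by linarith
  qed
qed

lemma block_pos_le:
  assumes "1 \<le> i" "i \<le> length ks" "a \<le> ks ! (i - 1)"
  shows "sum_list (take (i - 1) ks) + a \<le> sum_list (ks :: nat list)"
proof -
  have "sum_list (take i ks) = sum_list (take (i - 1) ks) + ks ! (i - 1)"
    using assms by (cases i) (auto simp: take_Suc_conv_app_nth)
  moreover have "sum_list (take i ks) + sum_list (drop i ks) = sum_list ks"
    by (metis append_take_drop_id sum_list_append)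
  ultimately show ?thesis using assms by linarith
qed

lemma sym_beta_apply:
  assumes "1 \<le> i" "i \<le> length ks" "1 \<le> a" "a \<le> ks ! (i - 1)"
  shows "sym_beta ks \<tau>s (sum_list (take (i - 1) ks) + a)
           = sum_list (take (i - 1) ks) + (\<tau>s ! (i - 1)) a"
  using block_eq[OF assms] block_pos_le[of i ks a] assms
  by (simp add: sym_beta_def)

lemma sym_delta_apply:
  assumes "1 \<le> i" "i \<le> length ks" "1 \<le> a" "a \<le> ks ! (i - 1)"
  shows "sym_delta ks \<sigma> (sum_list (take (i - 1) ks) + a)
           = (\<Sum>i' | i' \<in> {1..length ks} \<and> \<sigma> i' < \<sigma> i. ks ! (i' - 1)) + a"
  using block_eq[OF assms] block_pos_le[of i ks a] assms
  by (simp add: sym_delta_def)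

text \<open>The list \<open>(x\<^bsub>p(1)\<^esub>, \<dots>, x\<^bsub>p(n)\<^esub>)\<close>.\<close>

definition reindex :: "(nat \<Rightarrow> nat) \<Rightarrow> 'b list \<Rightarrow> 'b list" where
  "reindex p xs = map (\<lambda>i. xs ! (p i - 1)) [1..<Suc (length xs)]"

text \<open>
  In the interchange law the \<open>i\<close>th entry of \<open>fs'\<close> lies in \<open>\<Lambda>(k\<^sub>j)\<close> for \<open>j = g\<^sup>-\<^sup>1(i)\<close>, so the
  \<open>i\<close>th entry of its reindexing by \<open>g\<close> lies in \<open>\<Lambda>(k\<^sub>i)\<close>.
\<close>

locale action_operad =
  operad "\<lambda>n. carrier (G n)" u \<mu>
  for G :: "nat \<Rightarrow> 'a monoid"
    and \<pi> :: "nat \<Rightarrow> 'a \<Rightarrow> nat \<Rightarrow> nat"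
    and u :: 'a
    and \<mu> :: "nat list \<Rightarrow> 'a \<times> 'a list \<Rightarrow> 'a" +
  assumes group: "group (G n)"
    and proj_operad_map:
      "operad_map (\<lambda>n. carrier (G n)) u \<mu> (\<lambda>n. carrier (sym_group n)) \<one>\<^bsub>sym_group 1\<^esub> sym_comp \<pi>"
    and proj_hom: "\<pi> n \<in> hom (G n) (sym_group n)"
    and interchange:
      "\<lbrakk> g \<in> carrier (G (length ks)); g' \<in> carrier (G (length ks));
         fs \<in> listset (map (\<lambda>k. carrier (G k)) ks);
         fs' \<in> listset (map (\<lambda>k. carrier (G k)) (reindex (inv' (\<pi> (length ks) g)) ks)) \<rbrakk> \<Longrightarrow>
       \<mu> (reindex (inv' (\<pi> (length ks) g)) ks) (g', fs') \<otimes>\<^bsub>G (sum_list ks)\<^esub> \<mu> ks (g, fs)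
         = \<mu> ks (g' \<otimes>\<^bsub>G (length ks)\<^esub> g,
                 map2 (\<lambda>k (f', f). f' \<otimes>\<^bsub>G k\<^esub> f)
                   ks (zip (reindex (\<pi> (length ks) g) fs') fs))"

text \<open>
  \<open>DirProd_list\<close> is defined through image groups; its carrier and multiplication are the
  componentwise ones.
\<close>

lemma DirProd_list_carrier_listset:
  "carrier (DirProd_list Gs) = listset (map carrier Gs)"
  by (induct Gs) (auto simp: DirProd_list_def image_group_def set_Cons_def image_iff)

lemma DirProd_list_mult:
  assumes "xs \<in> carrier (DirProd_list Gs)" "ys \<in> carrier (DirProd_list Gs)"
  shows "xs \<otimes>\<^bsub>DirProd_list Gs\<^esub> ys = map2 (\<lambda>G (x, y). x \<otimes>\<^bsub>G\<^esub> y) Gs (zip xs ys)"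
  using assms
proof (induct Gs arbitrary: xs ys)
  case Nil
  then show ?case by (simp add: DirProd_list_def)
next
  case (Cons G Gs)
  obtain x xs' y ys' where xs: "xs = x # xs'" "x \<in> carrier G" "xs' \<in> carrier (DirProd_list Gs)"
    and ys: "ys = y # ys'" "y \<in> carrier G" "ys' \<in> carrier (DirProd_list Gs)"
    using Cons(2,3) unfolding DirProd_list_carrier by auto
  have "(\<lambda>(g, gs). g # gs) \<in> hom (G \<times>\<times> DirProd_list Gs) (DirProd_list (G # Gs))"
    using DirProd_list_iso[of G Gs] by (simp add: iso_def)
  from hom_mult[OF this, of "(x, xs')" "(y, ys')"] xs ys
  show ?case by (simp add: Cons(1))
qed

text \<open>
  \<open>\<beta>\<close> is given for nonempty lists only. Empty sublists do occur in the axioms (for instance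
  \<open>j\<^sub>i = 0\<close> in the associativity of \<open>\<beta>\<close>), and there \<open>\<beta>()\<close> is the identity element of \<open>\<Lambda>(0)\<close>,
  the only possible value of a homomorphism out of the empty product.
\<close>

definition beta_ext :: "(nat \<Rightarrow> 'a monoid) \<Rightarrow> (nat list \<Rightarrow> 'a list \<Rightarrow> 'a) \<Rightarrow> nat list \<Rightarrow> 'a list \<Rightarrow> 'a" where
  "beta_ext G \<beta> ks hs = (if ks = [] then \<one>\<^bsub>G 0\<^esub> else \<beta> ks hs)"

locale beta_delta_system =
  fixes G :: "nat \<Rightarrow> 'a monoid"
    and \<pi> :: "nat \<Rightarrow> 'a \<Rightarrow> nat \<Rightarrow> nat"
    and \<beta> :: "nat list \<Rightarrow> 'a list \<Rightarrow> 'a"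
    and \<delta> :: "nat list \<Rightarrow> 'a \<Rightarrow> 'a"
  assumes group: "group (G n)"
    and proj_hom: "\<pi> n \<in> hom (G n) (sym_group n)"
    and beta_hom:
      "\<beta> \<in> (\<Pi>\<^sub>E ks \<in> {ks. ks \<noteq> []}.
              hom (DirProd_list (map G ks)) (G (sum_list ks))
                \<inter> extensional (carrier (DirProd_list (map G ks))))"
    and delta_fun: "\<delta> ks \<in> carrier (G (length ks)) \<rightarrow>\<^sub>E carrier (G (sum_list ks))"
    and proj_beta:
      "gs \<in> carrier (DirProd_list (map G ks)) \<Longrightarrow>
       \<pi> (sum_list ks) (beta_ext G \<beta> ks gs) = sym_beta ks (map2 \<pi> ks gs)"
    and beta_single: "h \<in> carrier (G k) \<Longrightarrow> beta_ext G \<beta> [k] [h] = h"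
    and beta_assoc:
      "hss \<in> listset (map (\<lambda>ks. carrier (DirProd_list (map G ks))) kss) \<Longrightarrow>
       beta_ext G \<beta> (concat kss) (concat hss)
         = beta_ext G \<beta> (map sum_list kss) (map2 (beta_ext G \<beta>) kss hss)"
    and proj_delta:
      "g \<in> carrier (G (length ks)) \<Longrightarrow>
       \<pi> (sum_list ks) (\<delta> ks g) = sym_delta ks (\<pi> (length ks) g)"
    and delta_ones: "g \<in> carrier (G n) \<Longrightarrow> \<delta> (replicate n 1) g = g"
    and delta_one: "\<delta> ks \<one>\<^bsub>G (length ks)\<^esub> = \<one>\<^bsub>G (sum_list ks)\<^esub>"
    and delta_mult:
      "\<lbrakk> g \<in> carrier (G (length js)); h \<in> carrier (G (length js));
         ks = reindex (inv' (\<pi> (length js) h)) js \<rbrakk> \<Longrightarrow>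
       \<delta> ks g \<otimes>\<^bsub>G (sum_list js)\<^esub> \<delta> js h = \<delta> js (g \<otimes>\<^bsub>G (length js)\<^esub> h)"
    and delta_assoc:
      "g \<in> carrier (G (length pss)) \<Longrightarrow>
       \<delta> (concat pss) (\<delta> (map length pss) g) = \<delta> (map sum_list pss) g"
    and delta_beta:
      "\<lbrakk> g \<in> carrier (G (length ks)); hs \<in> carrier (DirProd_list (map G ks)) \<rbrakk> \<Longrightarrow>
       \<delta> ks g \<otimes>\<^bsub>G (sum_list ks)\<^esub> beta_ext G \<beta> ks hs
         = beta_ext G \<beta> (reindex (inv' (\<pi> (length ks) g)) ks) (reindex (inv' (\<pi> (length ks) g)) hs)
             \<otimes>\<^bsub>G (sum_list ks)\<^esub> \<delta> ks g"
    and beta_delta: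
      "gs \<in> carrier (DirProd_list (map G (map length mss))) \<Longrightarrow>
       beta_ext G \<beta> (map sum_list mss) (map2 \<delta> mss gs)
         = \<delta> (concat mss) (beta_ext G \<beta> (map length mss) gs)"

text \<open>\<open>\<beta>(h\<^sub>1, \<dots>, h\<^sub>n) = \<mu>(e\<^sub>n; h\<^sub>1, \<dots>, h\<^sub>n)\<close> and \<open>\<delta>(g) = \<mu>(g; e, \<dots>, e)\<close>.\<close>

definition beta_of :: "(nat \<Rightarrow> 'a monoid) \<Rightarrow> (nat list \<Rightarrow> 'a \<times> 'a list \<Rightarrow> 'a) \<Rightarrow> nat list \<Rightarrow> 'a list \<Rightarrow> 'a" where
  "beta_of G \<mu> =
     (\<lambda>ks \<in> {ks. ks \<noteq> []}. \<lambda>hs \<in> carrier (DirProd_list (map G ks)). \<mu> ks (\<one>\<^bsub>G (length ks)\<^esub>, hs))"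

definition delta_of :: "(nat \<Rightarrow> 'a monoid) \<Rightarrow> (nat list \<Rightarrow> 'a \<times> 'a list \<Rightarrow> 'a) \<Rightarrow> nat list \<Rightarrow> 'a \<Rightarrow> 'a" where
  "delta_of G \<mu> ks = (\<lambda>g \<in> carrier (G (length ks)). \<mu> ks (g, map (\<lambda>k. \<one>\<^bsub>G k\<^esub>) ks))"

end

theory Submission
  imports Defs
begin

text \<open>
  In an action operad the interchange law splits \<open>\<mu>(g; h\<^sub>1, \<dots>, h\<^sub>n)\<close> as
  \<open>\<delta>(g) \<beta>(h\<^sub>1, \<dots>, h\<^sub>n)\<close>, and an Eckmann-Hilton argument forces the operadic unit to be
  \<open>e\<^sub>1\<close>; hence \<open>\<beta>\<close> and \<open>\<delta>\<close> determine everything, and the axioms on them are special cases of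
  associativity and interchange. Conversely, let \<open>\<mu>\<close> be defined by this formula. Interchange
  follows by moving \<open>\<beta>\<close> past \<open>\<delta>\<close> with axiom (8) and then merging with (6). For associativity,
  \<open>\<delta>\<close> applied to a product \<open>\<delta>(x) \<beta>(y\<^sub>1, \<dots>, y\<^sub>n)\<close> is split by (6); the arities in the first
  factor get permuted by \<open>\<pi>(\<beta>(y\<^sub>1, \<dots>, y\<^sub>n))\<close>, but only within blocks, so (7) still applies to it,
  while (9) and (3) turn the other factors into values of \<open>\<beta>\<close>.
\<close>

section \<open>Reindexing and permutations of blocks\<close>

lemma length_reindex [simp]: "length (reindex p xs) = length xs"
  by (cases xs) (simp_all add: reindex_def del: upt_Suc)

lemma nth_reindex: "i < length xs \<Longrightarrow> reindex p xs ! i = xs ! (p (Suc i) - 1)"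
  by (simp add: reindex_def del: upt_Suc)

lemma reindex_id [simp]: "reindex id xs = xs" "reindex (\<lambda>x. x) xs = xs"
  by (auto intro!: nth_equalityI simp: nth_reindex)

text \<open>Position \<open>i\<close> of a list is the point \<open>Suc i\<close> of
  \<open>{1..n}\<close>. The image of that point is at least 1, so the truncated subtraction that
  leads back to a list position loses nothing.\<close>

lemma permutes_index_less:
  assumes "p permutes {1..n}" "i < n"
  shows "p (Suc i) - 1 < n" "Suc (p (Suc i) - 1) = p (Suc i)"
proof -
  have "p (Suc i) \<in> {1..n}" using permutes_in_image[OF assms(1), of "Suc i"] assms(2) by simp
  then show "p (Suc i) - 1 < n" "Suc (p (Suc i) - 1) = p (Suc i)" by auto
qed

text \<open>Permuting positions is a right action, hence the reversed order of composition: entry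
  \<open>i\<close> of the outer list is read at \<open>p i\<close> in the inner one, which reads
  \<open>xs\<close> at \<open>q (p i)\<close>.\<close>

lemma reindex_reindex:
  assumes "p permutes {1..length xs}"
  shows "reindex p (reindex q xs) = reindex (q \<circ> p) xs"
  using permutes_index_less[OF assms] by (auto intro!: nth_equalityI simp: nth_reindex)

lemma reindex_inv_cancel:
  assumes "p permutes {1..length xs}"
  shows "reindex p (reindex (inv' p) xs) = xs" "reindex (inv' p) (reindex p xs) = xs"
  using assms by (simp_all add: reindex_reindex permutes_inv permutes_inv_o)

lemma reindex_map:
  assumes "p permutes {1..length xs}"
  shows "reindex p (map f xs) = map f (reindex p xs)"
  using permutes_index_less[OF assms] by (auto intro!: nth_equalityI simp: nth_reindex)

lemma list_all2_reindex:
  assumes "p permutes {1..length ys}" "list_all2 P xs ys"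
  shows "list_all2 P (reindex p xs) (reindex p ys)"
  using assms permutes_index_less[OF assms(1)]
  by (auto simp: list_all2_conv_all_nth nth_reindex)

text \<open>A permutation maps the multiset of positions to itself. The consequence wanted is that
  permuted arities have the same sum, so that products formed over them lie in one group.\<close>

lemma mset_reindex:
  assumes "p permutes {1..length xs}"
  shows "mset (reindex p xs) = mset xs"
proof -
  have "reindex p xs = map (\<lambda>i. xs ! (i - 1)) (map p [1..<Suc (length xs)])"
    by (simp add: reindex_def)
  also have "mset \<dots> = image_mset (\<lambda>i. xs ! (i - 1)) (image_mset p (mset_set {1..length xs}))"
    by (simp add: atLeastLessThanSuc_atLeastAtMost multiset.map_comp comp_def del: upt_Suc)
  also have "image_mset p (mset_set {1..length xs}) = mset_set {1..length xs}"
    using assms by (rule permutes_image_mset)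
  also have "image_mset (\<lambda>i. xs ! (i - 1)) (mset_set {1..length xs})
      = mset (map (\<lambda>i. xs ! (i - 1)) [1..<Suc (length xs)])"
    by (simp add: atLeastLessThanSuc_atLeastAtMost del: upt_Suc)
  also have "map (\<lambda>i. xs ! (i - 1)) [1..<Suc (length xs)] = xs"
    by (auto intro!: nth_equalityI simp del: upt_Suc)
  finally show ?thesis .
qed

lemma sum_list_reindex:
  fixes ks :: "nat list"
  assumes "p permutes {1..length ks}"
  shows "sum_list (reindex p ks) = sum_list ks"
  by (metis mset_reindex[OF assms] sum_mset_sum_list)

section \<open>Block coordinates and block sums of permutations\<close>

lemma block_Cons_le: "1 \<le> x \<Longrightarrow> x \<le> k \<Longrightarrow> block (k # ks) x = 1"
  using block_eq[of 1 "k # ks" x] by simp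

text \<open>The block number \<open>i\<close> and the position \<open>a\<close> inside the block
  both count from 1; blocks of size 0 contain no point. In these coordinates
  \<open>sym_beta_apply\<close> and \<open>sym_delta_apply\<close> give the defining
  formulas.\<close>

lemma block_obtain:
  fixes ks :: "nat list"
  assumes "x \<in> {1..sum_list ks}"
  obtains i a where "1 \<le> i" "i \<le> length ks" "1 \<le> a" "a \<le> ks ! (i - 1)"
    "x = sum_list (take (i - 1) ks) + a"
  using assms
proof (induction ks arbitrary: x thesis)
  case Nil
  then show ?case by auto
next
  case (Cons k ks)
  show ?case
  proof (cases "x \<le> k")
    case True
    with Cons.prems(2) show ?thesis by (intro Cons.prems(1)[of 1 x]) auto
  next
    case False
    then have "x - k \<in> {1..sum_list ks}" using Cons.prems(2) by auto
    from Cons.IH[OF _ this] obtain i a where ia: "1 \<le> i" "i \<le> length ks" "1 \<le> a" "a \<le> ks ! (i - 1)"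
      "x - k = sum_list (take (i - 1) ks) + a" by blast
    from ia False show ?thesis by (intro Cons.prems(1)[of "Suc i" a]) (auto simp: take_Cons' nth_Cons')
  qed
qed

lemma sym_beta_ids: "sym_beta ks (map (\<lambda>k. id) ks) = id"
proof
  fix x
  show "sym_beta ks (map (\<lambda>k. id) ks) x = id x"
  proof (cases "x \<in> {1..sum_list ks}")
    case True
    from block_obtain[OF this] obtain i a where ia: "1 \<le> i" "i \<le> length ks" "1 \<le> a" "a \<le> ks ! (i - 1)"
      "x = sum_list (take (i - 1) ks) + a" .
    then show ?thesis using sym_beta_apply[OF ia(1-4)] by simp
  qed (auto simp: sym_beta_def)
qed

lemma sym_delta_id: "sym_delta ks id = id"
proof
  fix x
  show "sym_delta ks id x = id x"
  proof (cases "x \<in> {1..sum_list ks}")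
    case True
    from block_obtain[OF this] obtain i a where ia: "1 \<le> i" "i \<le> length ks" "1 \<le> a" "a \<le> ks ! (i - 1)"
      "x = sum_list (take (i - 1) ks) + a" .
    \<comment> \<open>For the identity, the blocks placed before block \<open>i\<close> are those of
      smaller number; a shift by one passes to list positions, and the sum is the offset of block
      \<open>i\<close>.\<close>
    have "(\<Sum>i' | i' \<in> {1..length ks} \<and> id i' < id i. ks ! (i' - 1)) = (\<Sum>j<i - 1. ks ! j)"
      using ia by (intro sum.reindex_bij_witness[of _ Suc "\<lambda>j. j - 1"]) auto
    also have "\<dots> = sum_list (take (i - 1) ks)"
      using ia by (simp add: sum_list_sum_nth atLeast0LessThan)
    finally show ?thesis using sym_delta_apply[OF ia(1-4), of id] ia(5) by simp
  qed (auto simp: sym_delta_def)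
qed

lemma sym_beta_Cons_le: "1 \<le> x \<Longrightarrow> x \<le> k \<Longrightarrow> sym_beta (k # ks) (\<tau> # \<tau>s) x = \<tau> x"
  by (simp add: sym_beta_def block_Cons_le)

text \<open>A new first block raises the block number by 1 and the offset by \<open>k\<close>. This
  makes \<open>sym_beta\<close> recursive in the list of blocks, as the inductions below
  need.\<close>

lemma sym_beta_Cons_gt:
  assumes "1 \<le> y" "y \<le> sum_list ks"
  shows "sym_beta (k # ks) (\<tau> # \<tau>s) (k + y) = k + sym_beta ks \<tau>s y"
proof -
  from assms obtain i a where ia: "1 \<le> i" "i \<le> length ks" "1 \<le> a" "a \<le> ks ! (i - 1)"
    "y = sum_list (take (i - 1) ks) + a"
    using block_obtain[of y ks] by auto
  have "sym_beta (k # ks) (\<tau> # \<tau>s) (sum_list (take (Suc i - 1) (k # ks)) + a)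
      = sum_list (take (Suc i - 1) (k # ks)) + ((\<tau> # \<tau>s) ! (Suc i - 1)) a"
    using ia by (intro sym_beta_apply) (auto simp: nth_Cons')
  then show ?thesis
    using sym_beta_apply[of i ks a \<tau>s] ia by (simp add: take_Cons' nth_Cons' add.assoc)
qed

lemma sym_beta_permutes:
  assumes "list_all2 (\<lambda>\<tau> k. \<tau> permutes {1..k}) \<tau>s ks"
    and "y \<in> {1..sum_list ks}"
  shows "sym_beta ks \<tau>s y \<in> {1..sum_list ks}"
  using assms
proof (induction arbitrary: y rule: list_all2_induct)
  case (Cons \<tau> \<tau>s k ks)
  show ?case
  proof (cases "y \<le> k")
    case True
    then have "\<tau> y \<in> {1..k}" using permutes_in_image[OF Cons.hyps(1), of y] Cons.prems by simp
    then show ?thesis using True Cons.prems by (auto simp: sym_beta_Cons_le)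
  next
    case False
    with Cons.prems have "y - k \<in> {1..sum_list ks}" by auto
    with Cons.IH[OF this] sym_beta_Cons_gt[of "y - k" ks k \<tau> \<tau>s] False show ?thesis by auto
  qed
qed simp

text \<open>By induction on the blocks: in the first block only \<open>\<tau>\<close> acts, and
  behind it \<open>sym_beta_Cons_gt\<close> shifts the remaining block sum by
  \<open>length xs\<close>.\<close>

lemma reindex_sym_beta:
  assumes "list_all2 (\<lambda>\<tau> k. \<tau> permutes {1..k}) \<tau>s (map length xss)"
  shows "reindex (sym_beta (map length xss) \<tau>s) (concat xss) = concat (map2 reindex \<tau>s xss)"
  using assms
proof (induction xss arbitrary: \<tau>s)
  case (Cons xs xss)
  then obtain \<tau> \<tau>s' where [simp]: "\<tau>s = \<tau> # \<tau>s'" and \<tau>: "\<tau> permutes {1..length xs}"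
    and \<tau>s': "list_all2 (\<lambda>\<tau> k. \<tau> permutes {1..k}) \<tau>s' (map length xss)"
    by (auto simp: list_all2_Cons2)
  have "reindex (sym_beta (map length (xs # xss)) \<tau>s) (xs @ concat xss)
      = reindex \<tau> xs @ reindex (sym_beta (map length xss) \<tau>s') (concat xss)"
  proof (rule nth_equalityI)
    fix j assume "j < length (reindex (sym_beta (map length (xs # xss)) \<tau>s) (xs @ concat xss))"
    then have j: "j < length xs + sum_list (map length xss)" by (simp add: length_concat)
    show "reindex (sym_beta (map length (xs # xss)) \<tau>s) (xs @ concat xss) ! j
      = (reindex \<tau> xs @ reindex (sym_beta (map length xss) \<tau>s') (concat xss)) ! j"
    proof (cases "j < length xs")
      case True
      then show ?thesis using permutes_index_less[OF \<tau> True]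
        by (simp add: nth_reindex nth_append sym_beta_Cons_le)
    next
      case False
      define y where "y = Suc j - length xs"
      have y: "1 \<le> y" "y \<le> sum_list (map length xss)" "Suc j = length xs + y"
        "Suc (j - length xs) = y"
        using False j by (auto simp: y_def)
      \<comment> \<open>The image of \<open>y\<close> is positive, so subtracting 1 commutes with
        adding the length of the first block.\<close>
      then obtain z where "sym_beta (map length xss) \<tau>s' y = Suc z"
        using sym_beta_permutes[OF \<tau>s', of y] by (auto simp: Suc_le_D dest!: Suc_le_D)
      then show ?thesis using False j y
        by (simp add: nth_reindex nth_append length_concat sym_beta_Cons_gt)
    qed
  qed (simp add: length_concat)
  then show ?case using Cons.IH[OF \<tau>s'] by simp
qed (simp add: reindex_def)

text \<open>The inverse of the block sum is not computed: permute each block by its inverse, apply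
  \<open>reindex_sym_beta\<close> to the result, and cancel. Cancelling uses that the block sum is a
  permutation.\<close>

lemma reindex_inv_sym_beta:
  assumes "list_all2 (\<lambda>\<tau> k. \<tau> permutes {1..k}) \<tau>s (map length xss)"
    and "sym_beta (map length xss) \<tau>s permutes {1..sum_list (map length xss)}"
  shows "reindex (inv' (sym_beta (map length xss) \<tau>s)) (concat xss)
    = concat (map2 (\<lambda>\<tau>. reindex (inv' \<tau>)) \<tau>s xss)"
proof -
  let ?yss = "map2 (\<lambda>\<tau>. reindex (inv' \<tau>)) \<tau>s xss"
  have len: "map length ?yss = map length xss"
    using assms(1) by (auto intro!: nth_equalityI simp: list_all2_conv_all_nth)
  have "map2 reindex \<tau>s ?yss = xss"
    using assms(1) by (auto intro!: nth_equalityI simp: list_all2_conv_all_nth reindex_inv_cancel)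
  then have "reindex (sym_beta (map length xss) \<tau>s) (concat ?yss) = concat xss"
    using reindex_sym_beta[of \<tau>s ?yss] assms(1) by (simp only: len)
  moreover have "length (concat ?yss) = sum_list (map length xss)"
    by (simp only: length_concat len)
  ultimately show ?thesis
    using reindex_inv_cancel(2)[of "sym_beta (map length xss) \<tau>s" "concat ?yss"] assms(2) by simp
qed

section \<open>Tuples\<close>

lemma listset_iff: "xs \<in> listset As \<longleftrightarrow> list_all2 (\<in>) xs As"
  by (induction As arbitrary: xs) (auto simp: set_Cons_def list_all2_Cons2)

lemma DirProd_map_carrier_iff:
  "xs \<in> carrier (DirProd_list (map G ks)) \<longleftrightarrow> list_all2 (\<lambda>x k. x \<in> carrier (G k)) xs ks"
  by (simp add: DirProd_list_carrier_listset listset_iff list_all2_map2)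

lemma DirProd_map_mult:
  assumes "xs \<in> carrier (DirProd_list (map G ks))" "ys \<in> carrier (DirProd_list (map G ks))"
  shows "xs \<otimes>\<^bsub>DirProd_list (map G ks)\<^esub> ys = map2 (\<lambda>k (x, y). x \<otimes>\<^bsub>G k\<^esub> y) ks (zip xs ys)"
  using DirProd_list_mult[OF assms] by (simp add: map_zip_map case_prod_unfold)

lemma listset_map_iff:
  "xs \<in> listset (map X ks) \<longleftrightarrow> list_all2 (\<lambda>x k. x \<in> X k) xs ks"
  by (simp add: listset_iff list_all2_map2)

text \<open>The data shared by \<open>action_operad\<close> and \<open>beta_delta_system\<close>;
  both become sublocales, so the calculus of tuples is set up once.\<close>

locale graded_group =
  fixes G :: "nat \<Rightarrow> 'a monoid"
    and \<pi> :: "nat \<Rightarrow> 'a \<Rightarrow> nat \<Rightarrow> nat"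
  assumes is_group: "group (G n)"
    and is_hom: "\<pi> n \<in> hom (G n) (sym_group n)"
begin

abbreviation tuple :: "'a list \<Rightarrow> nat list \<Rightarrow> bool" where
  "tuple \<equiv> list_all2 (\<lambda>x k. x \<in> carrier (G k))"

abbreviation ones :: "nat list \<Rightarrow> 'a list" where
  "ones ks \<equiv> map (\<lambda>k. \<one>\<^bsub>G k\<^esub>) ks"

abbreviation tuple_mult :: "nat list \<Rightarrow> 'a list \<Rightarrow> 'a list \<Rightarrow> 'a list" where
  "tuple_mult ks xs ys \<equiv> map2 (\<lambda>k (x, y). x \<otimes>\<^bsub>G k\<^esub> y) ks (zip xs ys)"

lemma one_mem [simp, intro]: "\<one>\<^bsub>G n\<^esub> \<in> carrier (G n)"
  using is_group by (simp add: group.is_monoid)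

lemma mult_mem [simp, intro]:
  "x \<in> carrier (G n) \<Longrightarrow> y \<in> carrier (G n) \<Longrightarrow> x \<otimes>\<^bsub>G n\<^esub> y \<in> carrier (G n)"
  using is_group by (simp add: group.is_monoid monoid.m_closed)

lemma one_mult [simp]: "x \<in> carrier (G n) \<Longrightarrow> \<one>\<^bsub>G n\<^esub> \<otimes>\<^bsub>G n\<^esub> x = x"
  using is_group by (simp add: group.is_monoid monoid.l_one)

lemma mult_one [simp]: "x \<in> carrier (G n) \<Longrightarrow> x \<otimes>\<^bsub>G n\<^esub> \<one>\<^bsub>G n\<^esub> = x"
  using is_group by (simp add: group.is_monoid monoid.r_one)

lemma mult_assoc:
  "x \<in> carrier (G n) \<Longrightarrow> y \<in> carrier (G n) \<Longrightarrow> z \<in> carrier (G n) \<Longrightarrow>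
   x \<otimes>\<^bsub>G n\<^esub> y \<otimes>\<^bsub>G n\<^esub> z = x \<otimes>\<^bsub>G n\<^esub> (y \<otimes>\<^bsub>G n\<^esub> z)"
  using is_group by (simp add: group.is_monoid monoid.m_assoc)

lemma idempotent_eq_one:
  "x \<in> carrier (G n) \<Longrightarrow> x \<otimes>\<^bsub>G n\<^esub> x = x \<Longrightarrow> x = \<one>\<^bsub>G n\<^esub>"
  using group.l_cancel_one[OF is_group] by blast

lemma proj_permutes: "g \<in> carrier (G n) \<Longrightarrow> \<pi> n g permutes {1..n}"
  using is_hom[of n] by (auto simp: hom_def sym_group_carrier)

lemma proj_mult: "g \<in> carrier (G n) \<Longrightarrow> h \<in> carrier (G n) \<Longrightarrow> \<pi> n (g \<otimes>\<^bsub>G n\<^esub> h) = \<pi> n g \<circ> \<pi> n h"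
  using is_hom[of n] by (auto simp: hom_def sym_group_mult)

lemma proj_one [simp]: "\<pi> n \<one>\<^bsub>G n\<^esub> = id"
  using hom_one[OF is_hom is_group sym_group_is_group] by (simp add: sym_group_one)

lemma tuple_ones: "tuple (ones ks) ks"
  by (simp add: list_all2_conv_all_nth)

lemma tuple_tuple_mult: "tuple xs ks \<Longrightarrow> tuple ys ks \<Longrightarrow> tuple (tuple_mult ks xs ys) ks"
  by (auto simp: list_all2_conv_all_nth)

lemma tuple_mult_ones:
  assumes "tuple xs ks"
  shows "tuple_mult ks (ones ks) xs = xs" "tuple_mult ks xs (ones ks) = xs"
  using assms by (auto simp: list_all2_conv_all_nth intro!: nth_equalityI)

lemma tuple_reindex:
  "p permutes {1..length ks} \<Longrightarrow> tuple xs ks \<Longrightarrow> tuple (reindex p xs) (reindex p ks)"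
  by (rule list_all2_reindex)

text \<open>For \<open>p\<close> the projection of \<open>g\<close>, the left side is the arity
  condition on the tuple \<open>f'\<close> in the interchange law; the right side is what lets
  \<open>f'_{g(i)}\<close> be multiplied with \<open>f_i\<close>.\<close>

lemma tuple_reindex_iff:
  assumes "p permutes {1..length ks}"
  shows "tuple xs (reindex (inv' p) ks) \<longleftrightarrow> tuple (reindex p xs) ks"
proof
  assume "tuple xs (reindex (inv' p) ks)"
  from tuple_reindex[OF _ this, of p] assms show "tuple (reindex p xs) ks"
    by (simp add: reindex_inv_cancel)
next
  assume *: "tuple (reindex p xs) ks"
  then have "length xs = length ks" by (simp add: list_all2_conv_all_nth)
  with tuple_reindex[OF permutes_inv[OF assms] *] assms show "tuple xs (reindex (inv' p) ks)"
    by (simp add: reindex_inv_cancel)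
qed

lemma reindex_ones: "p permutes {1..length ks} \<Longrightarrow> reindex p (ones ks) = ones (reindex p ks)"
  by (rule reindex_map) simp

lemma tuple_proj:
  "tuple hs ks \<Longrightarrow> list_all2 (\<lambda>\<tau> k. \<tau> permutes {1..k}) (map2 \<pi> ks hs) ks"
  using proj_permutes by (auto simp: list_all2_conv_all_nth)

lemma proj_ones: "map2 \<pi> ks (ones ks) = map (\<lambda>k. id) ks"
  by (auto intro!: nth_equalityI)

lemma tuple_concat: "list_all2 tuple xss kss \<Longrightarrow> tuple (concat xss) (concat kss)"
  by (induction rule: list_all2_induct) (auto intro: list_all2_appendI)

end

text \<open>The composition recovered from \<beta> and \<delta>. It is restricted to its domain
  because an operad composition is extensional; \<open>beta_ext\<close> covers n = 0.\<close>

definition comp_of ::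
  "(nat \<Rightarrow> 'a monoid) \<Rightarrow> (nat list \<Rightarrow> 'a list \<Rightarrow> 'a) \<Rightarrow> (nat list \<Rightarrow> 'a \<Rightarrow> 'a) \<Rightarrow>
   nat list \<Rightarrow> 'a \<times> 'a list \<Rightarrow> 'a" where
  "comp_of G \<beta> \<delta> ks =
     (\<lambda>(g, hs) \<in> carrier (G (length ks)) \<times> listset (map (\<lambda>k. carrier (G k)) ks).
        \<delta> ks g \<otimes>\<^bsub>G (sum_list ks)\<^esub> beta_ext G \<beta> ks hs)"

section \<open>From an action operad to \<open>\<beta>\<close> and \<open>\<delta>\<close>\<close>

sublocale action_operad \<subseteq> graded_group G \<pi>
  by (simp add: graded_group_def group proj_hom)

context action_operad
begin

lemma comp_mem [simp]:
  assumes "g \<in> carrier (G (length ks))" "tuple hs ks"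
  shows "\<mu> ks (g, hs) \<in> carrier (G (sum_list ks))"
  using comp_closed[of ks] assms by (auto simp: PiE_iff listset_map_iff)

lemma comp_assoc:
  assumes "x \<in> carrier (G (length mss))" "tuple ys (map length mss)" "list_all2 tuple zss mss"
  shows "\<mu> (concat mss) (\<mu> (map length mss) (x, ys), concat zss)
    = \<mu> (map sum_list mss) (x, map2 \<mu> mss (zip ys zss))"
  using assms by (intro assoc) (simp_all only: listset_map_iff)

lemma proj_comp:
  assumes "g \<in> carrier (G (length ks))" "tuple hs ks"
  shows "\<pi> (sum_list ks) (\<mu> ks (g, hs)) = sym_delta ks (\<pi> (length ks) g) \<circ> sym_beta ks (map2 \<pi> ks hs)"
proof -
  have "\<pi> (sum_list ks) (\<mu> ks (g, hs)) = sym_comp ks (\<pi> (length ks) g, map2 \<pi> ks hs)"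
    using proj_operad_map assms unfolding operad_map_def listset_map_iff by blast
  also have "\<dots> = sym_delta ks (\<pi> (length ks) g) \<circ> sym_beta ks (map2 \<pi> ks hs)"
    using proj_permutes[OF assms(1)] tuple_proj[OF assms(2)]
    by (simp add: sym_comp_def listset_map_iff sym_group_carrier sym_group_mult)
  finally show ?thesis .
qed

lemma interchange_tuple:
  assumes "g \<in> carrier (G (length ks))" "g' \<in> carrier (G (length ks))" "tuple fs ks"
    "tuple fs' (reindex (inv' (\<pi> (length ks) g)) ks)"
  shows "\<mu> (reindex (inv' (\<pi> (length ks) g)) ks) (g', fs') \<otimes>\<^bsub>G (sum_list ks)\<^esub> \<mu> ks (g, fs)
    = \<mu> ks (g' \<otimes>\<^bsub>G (length ks)\<^esub> g, tuple_mult ks (reindex (\<pi> (length ks) g) fs') fs)"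
  using assms by (intro interchange) (simp_all only: listset_map_iff)

text \<open>With e_n as the right factor nothing is reindexed, as \<pi>(e_n) is the identity.
  Eckmann-Hilton, the splitting of \<mu> and the multiplicativity of \<beta> all come from this
  case.\<close>

lemma interchange_one:
  assumes "g \<in> carrier (G (length ks))" "tuple fs ks" "tuple fs' ks"
  shows "\<mu> ks (g, fs') \<otimes>\<^bsub>G (sum_list ks)\<^esub> \<mu> ks (\<one>\<^bsub>G (length ks)\<^esub>, fs) = \<mu> ks (g, tuple_mult ks fs' fs)"
  using interchange_tuple[of "\<one>\<^bsub>G (length ks)\<^esub>" ks g fs fs'] assms by (simp add: inv_id)

text \<open>Eckmann-Hilton.\<close>

lemma unit_eq_one: "u = \<one>\<^bsub>G 1\<^esub>"
proof -
  have u: "u \<in> carrier (G 1)" by (rule unit_closed)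
  \<comment> \<open>Interchange multiplies \<mu>(u; e) and \<mu>(e; u) to \<mu>(u; u). The unit laws
    evaluate these as e, e and u, hence u = e.\<close>
  have "\<mu> [1] (u, [\<one>\<^bsub>G 1\<^esub>]) \<otimes>\<^bsub>G 1\<^esub> \<mu> [1] (\<one>\<^bsub>G 1\<^esub>, [u]) = \<mu> [1] (u, [u])"
    using interchange_one[of u "[1]" "[u]" "[\<one>\<^bsub>G 1\<^esub>]"] u by simp
  moreover have "\<mu> [1] (\<one>\<^bsub>G 1\<^esub>, [u]) = \<one>\<^bsub>G 1\<^esub>" using right_unit[of "\<one>\<^bsub>G 1\<^esub>" 1] by simp
  moreover have "\<mu> [1] (u, [\<one>\<^bsub>G 1\<^esub>]) = \<one>\<^bsub>G 1\<^esub>" by (rule left_unit) simp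
  moreover have "\<mu> [1] (u, [u]) = u" using u by (rule left_unit)
  ultimately show ?thesis by simp
qed

text \<open>Interchange makes this element idempotent, and a group has only one idempotent.\<close>

lemma comp_ones: "\<mu> ks (\<one>\<^bsub>G (length ks)\<^esub>, ones ks) = \<one>\<^bsub>G (sum_list ks)\<^esub>"
  using interchange_one[of "\<one>\<^bsub>G (length ks)\<^esub>" ks "ones ks" "ones ks"]
  by (intro idempotent_eq_one) (simp_all add: tuple_ones tuple_mult_ones)

lemma comp_split:
  assumes "g \<in> carrier (G (length ks))" "tuple hs ks"
  shows "\<mu> ks (g, ones ks) \<otimes>\<^bsub>G (sum_list ks)\<^esub> \<mu> ks (\<one>\<^bsub>G (length ks)\<^esub>, hs) = \<mu> ks (g, hs)"
  using interchange_one[of g ks hs "ones ks"] assms by (simp add: tuple_ones tuple_mult_ones)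

lemma comp_Nil: "x \<in> carrier (G 0) \<Longrightarrow> \<mu> [] (x, []) = x"
  using right_unit[of x 0] by simp

text \<open>For the empty list the default value e_0 of \<open>beta_ext\<close> agrees with \<mu>,
  by the right unit law at n = 0. So the axioms below call for no separate treatment of empty
  lists.\<close>

lemma beta_ext_beta_of:
  "tuple hs ks \<Longrightarrow> beta_ext G (beta_of G \<mu>) ks hs = \<mu> ks (\<one>\<^bsub>G (length ks)\<^esub>, hs)"
  by (cases "ks = []") (auto simp: beta_ext_def beta_of_def DirProd_map_carrier_iff comp_Nil)

lemma delta_of_eq: "g \<in> carrier (G (length ks)) \<Longrightarrow> delta_of G \<mu> ks g = \<mu> ks (g, ones ks)"
  by (simp add: delta_of_def)

lemma map2_comp_ones:
  assumes "list_all2 tuple hss kss"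
  shows "map2 \<mu> kss (zip (ones (map length kss)) hss) = map2 (beta_ext G (beta_of G \<mu>)) kss hss"
  using assms by (auto simp: list_all2_conv_all_nth beta_ext_beta_of intro!: nth_equalityI)

lemma ones_concat: "ones (concat kss) = concat (map ones kss)"
  by (simp add: map_concat)

section \<open>Verification of the axioms for \<beta> and \<delta>\<close>

lemma beta_of_hom:
  "beta_of G \<mu> ks \<in> hom (DirProd_list (map G ks)) (G (sum_list ks))" if "ks \<noteq> []"
proof (rule homI)
  fix x assume "x \<in> carrier (DirProd_list (map G ks))"
  then show "beta_of G \<mu> ks x \<in> carrier (G (sum_list ks))"
    using that by (simp add: beta_of_def DirProd_map_carrier_iff)
next
  fix x y
  assume "x \<in> carrier (DirProd_list (map G ks))" "y \<in> carrier (DirProd_list (map G ks))"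
  then show "beta_of G \<mu> ks (x \<otimes>\<^bsub>DirProd_list (map G ks)\<^esub> y)
      = beta_of G \<mu> ks x \<otimes>\<^bsub>G (sum_list ks)\<^esub> beta_of G \<mu> ks y"
    using that interchange_one[of "\<one>\<^bsub>G (length ks)\<^esub>" ks y x]
    by (simp add: beta_of_def DirProd_map_mult DirProd_map_carrier_iff tuple_tuple_mult)
qed

lemma system: "beta_delta_system G \<pi> (beta_of G \<mu>) (delta_of G \<mu>)"
proof (rule beta_delta_system.intro)
  show "group (G n)" "\<pi> n \<in> hom (G n) (sym_group n)" for n by (rule group proj_hom)+
  show "beta_of G \<mu> \<in> (\<Pi>\<^sub>E ks \<in> {ks. ks \<noteq> []}. hom (DirProd_list (map G ks)) (G (sum_list ks))
                \<inter> extensional (carrier (DirProd_list (map G ks))))"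
    using beta_of_hom by (auto simp: PiE_iff beta_of_def)
  show "delta_of G \<mu> ks \<in> carrier (G (length ks)) \<rightarrow>\<^sub>E carrier (G (sum_list ks))" for ks
    by (simp add: delta_of_def tuple_ones)
  show "\<pi> (sum_list ks) (beta_ext G (beta_of G \<mu>) ks gs) = sym_beta ks (map2 \<pi> ks gs)"
    if "gs \<in> carrier (DirProd_list (map G ks))" for gs ks
    using that by (simp add: DirProd_map_carrier_iff beta_ext_beta_of proj_comp sym_delta_id)
  show "beta_ext G (beta_of G \<mu>) [k] [h] = h" if "h \<in> carrier (G k)" for h k
    using that left_unit[of h k] by (simp add: beta_ext_beta_of unit_eq_one)
  show "beta_ext G (beta_of G \<mu>) (concat kss) (concat hss)
      = beta_ext G (beta_of G \<mu>) (map sum_list kss) (map2 (beta_ext G (beta_of G \<mu>)) kss hss)"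
    if "hss \<in> listset (map (\<lambda>ks. carrier (DirProd_list (map G ks))) kss)" for kss hss
  proof -
    from that have hss: "list_all2 tuple hss kss"
      by (simp add: listset_map_iff DirProd_map_carrier_iff)
    then have "tuple (map2 (beta_ext G (beta_of G \<mu>)) kss hss) (map sum_list kss)"
      by (auto simp: list_all2_conv_all_nth beta_ext_beta_of)
    \<comment> \<open>Operadic associativity with identity elements on the two outer levels, which
      \<open>comp_ones\<close> collapses.\<close>
    then show ?thesis
      using comp_assoc[of "\<one>\<^bsub>G (length kss)\<^esub>" kss "ones (map length kss)" hss] hss
        comp_ones[of "map length kss"]
      by (simp add: beta_ext_beta_of tuple_concat tuple_ones map2_comp_ones length_concat
          del: map_map)
  qed
  show "\<pi> (sum_list ks) (delta_of G \<mu> ks g) = sym_delta ks (\<pi> (length ks) g)"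
    if "g \<in> carrier (G (length ks))" for g ks
    using that by (simp add: delta_of_eq proj_comp tuple_ones proj_ones sym_beta_ids)
  \<comment> \<open>By \<open>unit_eq_one\<close> the units in the right unit law are the identity
    elements inserted by \<open>delta_of\<close>.\<close>
  show "delta_of G \<mu> (replicate n 1) g = g" if "g \<in> carrier (G n)" for g n
    using that right_unit[of g n] by (simp add: delta_of_eq unit_eq_one)
  show "delta_of G \<mu> ks \<one>\<^bsub>G (length ks)\<^esub> = \<one>\<^bsub>G (sum_list ks)\<^esub>" for ks
    by (simp add: delta_of_eq comp_ones)
  show "delta_of G \<mu> ks g \<otimes>\<^bsub>G (sum_list js)\<^esub> delta_of G \<mu> js h
      = delta_of G \<mu> js (g \<otimes>\<^bsub>G (length js)\<^esub> h)"
    if "g \<in> carrier (G (length js))" "h \<in> carrier (G (length js))"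
      "ks = reindex (inv' (\<pi> (length js) h)) js" for g js h ks
  proof -
    note p = proj_permutes[OF that(2)]
    \<comment> \<open>Interchange with both tuples trivial: reindexing by the projection of
      \<open>h\<close> carries the identities over \<open>ks\<close> to those over
      \<open>js\<close>.\<close>
    show ?thesis
      using that interchange_tuple[of h js g "ones js" "ones ks"] p
      by (simp add: delta_of_eq tuple_ones reindex_ones permutes_inv reindex_inv_cancel
          tuple_mult_ones flip: reindex_ones)
  qed
  show "delta_of G \<mu> (concat pss) (delta_of G \<mu> (map length pss) g) = delta_of G \<mu> (map sum_list pss) g"
    if "g \<in> carrier (G (length pss))" for g pss
  proof -
    have "map2 \<mu> pss (zip (ones (map length pss)) (map ones pss)) = ones (map sum_list pss)"
      by (auto simp: comp_ones intro!: nth_equalityI)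
    moreover have "list_all2 tuple (map ones pss) pss"
      by (simp add: list_all2_conv_all_nth tuple_ones)
    moreover have "\<mu> (map length pss) (g, ones (map length pss)) \<in> carrier (G (length (concat pss)))"
      using comp_mem[of g "map length pss" "ones (map length pss)"] that tuple_ones[of "map length pss"]
      by (simp add: length_concat del: map_map)
    ultimately show ?thesis
      using comp_assoc[of g pss "ones (map length pss)" "map ones pss"] that
      by (simp add: delta_of_eq tuple_ones ones_concat del: map_map)
  qed
  show "delta_of G \<mu> ks g \<otimes>\<^bsub>G (sum_list ks)\<^esub> beta_ext G (beta_of G \<mu>) ks hs
      = beta_ext G (beta_of G \<mu>) (reindex (inv' (\<pi> (length ks) g)) ks) (reindex (inv' (\<pi> (length ks) g)) hs)
          \<otimes>\<^bsub>G (sum_list ks)\<^esub> delta_of G \<mu> ks g"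
    if "g \<in> carrier (G (length ks))" "hs \<in> carrier (DirProd_list (map G ks))" for g ks hs
  proof -
    note p = proj_permutes[OF that(1)]
    from that have hs: "tuple hs ks" by (simp add: DirProd_map_carrier_iff)
    then have len: "length hs = length ks" by (simp add: list_all2_conv_all_nth)
    note t = tuple_reindex[OF permutes_inv[OF p] hs]
    \<comment> \<open>Both sides equal \<mu>(g; h_1, ..., h_n): the left by
      \<open>comp_split\<close>, the right by interchange of \<mu>(e; permuted \<open>hs\<close>)
      with \<mu>(g; e, ..., e).\<close>
    show ?thesis
      using interchange_tuple[OF that(1) _ tuple_ones t, of "\<one>\<^bsub>G (length ks)\<^esub>"] that(1) hs p t
        comp_split[OF that(1) hs]
      by (simp add: delta_of_eq beta_ext_beta_of reindex_inv_cancel len tuple_mult_ones)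
  qed
  show "beta_ext G (beta_of G \<mu>) (map sum_list mss) (map2 (delta_of G \<mu>) mss gs)
      = delta_of G \<mu> (concat mss) (beta_ext G (beta_of G \<mu>) (map length mss) gs)"
    if "gs \<in> carrier (DirProd_list (map G (map length mss)))" for mss gs
  proof -
    from that have gs: "tuple gs (map length mss)" by (simp only: DirProd_map_carrier_iff)
    have ones: "list_all2 tuple (map ones mss) mss"
      by (simp add: list_all2_conv_all_nth tuple_ones)
    have eq: "map2 \<mu> mss (zip gs (map ones mss)) = map2 (delta_of G \<mu>) mss gs"
      using gs by (auto simp: list_all2_conv_all_nth delta_of_eq intro!: nth_equalityI)
    have "tuple (map2 (delta_of G \<mu>) mss gs) (map sum_list mss)"
      using gs by (auto simp: list_all2_conv_all_nth delta_of_eq)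
    moreover have "\<mu> (map length mss) (\<one>\<^bsub>G (length mss)\<^esub>, gs) \<in> carrier (G (length (concat mss)))"
      using comp_mem[of "\<one>\<^bsub>G (length mss)\<^esub>" "map length mss" gs] gs by (simp add: length_concat)
    \<comment> \<open>Operadic associativity with identity elements on the outermost and innermost
      levels and \<open>gs\<close> between them.\<close>
    ultimately show ?thesis
      using comp_assoc[OF _ gs ones, of "\<one>\<^bsub>G (length mss)\<^esub>"] gs
      by (simp add: delta_of_eq beta_ext_beta_of ones_concat eq)
  qed
qed

text \<open>On the domain this is \<open>comp_split\<close>; off it both sides are undefined, as
  \<mu> is extensional.\<close>

lemma comp_of_eq: "comp_of G (beta_of G \<mu>) (delta_of G \<mu>) = \<mu>"
proof
  fix ks
  show "comp_of G (beta_of G \<mu>) (delta_of G \<mu>) ks = \<mu> ks"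
  proof (rule extensionalityI)
    show "\<mu> ks \<in> extensional (carrier (G (length ks)) \<times> listset (map (\<lambda>k. carrier (G k)) ks))"
      using comp_closed[of ks] by (simp add: PiE_iff)
    show "comp_of G (beta_of G \<mu>) (delta_of G \<mu>) ks
        \<in> extensional (carrier (G (length ks)) \<times> listset (map (\<lambda>k. carrier (G k)) ks))"
      by (simp add: comp_of_def)
    fix x assume "x \<in> carrier (G (length ks)) \<times> listset (map (\<lambda>k. carrier (G k)) ks)"
    then show "comp_of G (beta_of G \<mu>) (delta_of G \<mu>) ks x = \<mu> ks x"
      by (auto simp: comp_of_def listset_map_iff delta_of_eq beta_ext_beta_of comp_split)
  qed
qed

end

section \<open>From \<open>\<beta>\<close> and \<open>\<delta>\<close> to an action operad\<close>

sublocale beta_delta_system \<subseteq> graded_group G \<pi>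
  by (simp add: graded_group_def group proj_hom)

context beta_delta_system
begin

abbreviation B :: "nat list \<Rightarrow> 'a list \<Rightarrow> 'a" where
  "B \<equiv> beta_ext G \<beta>"

section \<open>The composition built from \<beta> and \<delta>\<close>

lemma beta_is_hom: "ks \<noteq> [] \<Longrightarrow> \<beta> ks \<in> hom (DirProd_list (map G ks)) (G (sum_list ks))"
  using beta_hom by (auto simp: PiE_iff)

lemma beta_mem [simp]: "tuple hs ks \<Longrightarrow> B ks hs \<in> carrier (G (sum_list ks))"
  using hom_in_carrier[OF beta_is_hom, of ks hs]
  by (auto simp: beta_ext_def DirProd_map_carrier_iff)

lemma beta_mult:
  assumes "tuple xs ks" "tuple ys ks"
  shows "B ks xs \<otimes>\<^bsub>G (sum_list ks)\<^esub> B ks ys = B ks (tuple_mult ks xs ys)"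
  using hom_mult[OF beta_is_hom, of ks xs ys] assms
  by (simp add: beta_ext_def DirProd_map_mult DirProd_map_carrier_iff)

lemma beta_ones: "B ks (ones ks) = \<one>\<^bsub>G (sum_list ks)\<^esub>"
  using beta_mult[OF tuple_ones tuple_ones, of ks]
  by (intro idempotent_eq_one) (simp_all add: tuple_ones tuple_mult_ones)

lemma delta_mem [simp]: "g \<in> carrier (G (length ks)) \<Longrightarrow> \<delta> ks g \<in> carrier (G (sum_list ks))"
  using delta_fun[of ks] by auto

abbreviation \<mu> :: "nat list \<Rightarrow> 'a \<times> 'a list \<Rightarrow> 'a" where
  "\<mu> \<equiv> comp_of G \<beta> \<delta>"

lemma comp_eq:
  "g \<in> carrier (G (length ks)) \<Longrightarrow> tuple hs ks \<Longrightarrow> \<mu> ks (g, hs) = \<delta> ks g \<otimes>\<^bsub>G (sum_list ks)\<^esub> B ks hs"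
  by (simp add: comp_of_def listset_map_iff)

lemma comp_mem:
  "g \<in> carrier (G (length ks)) \<Longrightarrow> tuple hs ks \<Longrightarrow> \<mu> ks (g, hs) \<in> carrier (G (sum_list ks))"
  by (simp add: comp_eq)

text \<open>
  \<open>\<pi>(\<beta>(y\<^sub>1, \<dots>, y\<^sub>n))\<close> permutes \<open>concat mss\<close> within its blocks, which changes neither the
  lengths nor the sums of the blocks; so associativity of \<open>\<delta>\<close> does not see it.
\<close>

lemma delta_reindex_blocks:
  assumes "x \<in> carrier (G (length mss))" "tuple ys (map length mss)"
  shows "\<delta> (reindex (inv' (\<pi> (length (concat mss)) (B (map length mss) ys))) (concat mss))
      (\<delta> (map length mss) x) = \<delta> (map sum_list mss) x"
proof -
  let ?\<tau>s = "map2 \<pi> (map length mss) ys"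
  define pss where "pss = map2 (\<lambda>\<tau>. reindex (inv' \<tau>)) ?\<tau>s mss"
  have y: "B (map length mss) ys \<in> carrier (G (length (concat mss)))"
    using beta_mem[OF assms(2)] by (simp add: length_concat)
  have proj: "\<pi> (length (concat mss)) (B (map length mss) ys) = sym_beta (map length mss) ?\<tau>s"
    using proj_beta[of ys "map length mss"] assms(2)
    by (simp only: DirProd_map_carrier_iff length_concat)
  \<comment> \<open>Bijectivity of the block sum comes from the group side: it is the projection of
    a group element.\<close>
  have "reindex (inv' (sym_beta (map length mss) ?\<tau>s)) (concat mss) = concat pss"
    unfolding pss_def
    using proj_permutes[OF y, unfolded proj] tuple_proj[OF assms(2)]
    by (intro reindex_inv_sym_beta) (simp_all only: length_concat)
  moreover have "map length pss = map length mss"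
    using assms(2) by (auto simp: pss_def list_all2_conv_all_nth intro!: nth_equalityI)
  moreover have "map sum_list pss = map sum_list mss"
    using assms(2) proj_permutes
    by (auto simp: pss_def list_all2_conv_all_nth sum_list_reindex permutes_inv intro!: nth_equalityI)
  moreover have "length pss = length mss"
    using assms(2) by (simp add: pss_def list_all2_conv_all_nth)
  ultimately show ?thesis using delta_assoc[of x pss] assms(1) by (simp add: proj)
qed

section \<open>Associativity and interchange of this composition\<close>

lemma comp_assoc:
  assumes x: "x \<in> carrier (G (length mss))" and ys: "tuple ys (map length mss)"
    and zss: "list_all2 tuple zss mss"
  shows "\<mu> (concat mss) (\<mu> (map length mss) (x, ys), concat zss)
    = \<mu> (map sum_list mss) (x, map2 \<mu> mss (zip ys zss))"
proof -
  let ?N = "sum_list (concat mss)"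
  let ?d = "map2 \<delta> mss ys" and ?b = "map2 B mss zss"
  \<comment> \<open>\<open>N\<close> and \<open>len\<close> identify differently written arities,
    which index the groups in which the products are taken.\<close>
  have N: "?N = sum_list (map sum_list mss)" by (induction mss) auto
  have len: "length (concat mss) = sum_list (map length mss)" by (rule length_concat)
  have x': "\<delta> (map length mss) x \<in> carrier (G (length (concat mss)))"
    using delta_mem[of x "map length mss"] x by (simp add: len)
  have y': "B (map length mss) ys \<in> carrier (G (length (concat mss)))"
    using beta_mem[OF ys] by (simp add: len)
  have d: "tuple ?d (map sum_list mss)" and b: "tuple ?b (map sum_list mss)"
    using ys zss by (auto simp: list_all2_conv_all_nth)
  \<comment> \<open>The entrywise products \<delta>(y_i) \<beta>(z_i1, ...) are the inner
    composites, so the two values of \<beta> arising below merge into the one wanted.\<close>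
  have db: "tuple_mult (map sum_list mss) ?d ?b = map2 \<mu> mss (zip ys zss)"
    using ys zss by (auto simp: list_all2_conv_all_nth comp_eq intro!: nth_equalityI)
  have zs: "tuple (concat zss) (concat mss)" using zss by (rule tuple_concat)
  have dx: "\<delta> (map sum_list mss) x \<in> carrier (G ?N)"
    using delta_mem[of x "map sum_list mss"] x by (simp add: N)
  have "\<mu> (map length mss) (x, ys)
      = \<delta> (map length mss) x \<otimes>\<^bsub>G (length (concat mss))\<^esub> B (map length mss) ys"
    using comp_eq[OF _ ys] x by (simp add: len)
  then have "\<mu> (concat mss) (\<mu> (map length mss) (x, ys), concat zss)
      = \<delta> (concat mss) (\<delta> (map length mss) x \<otimes>\<^bsub>G (length (concat mss))\<^esub> B (map length mss) ys)
        \<otimes>\<^bsub>G ?N\<^esub> B (concat mss) (concat zss)"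
    using x' y' zs by (simp add: comp_eq)
  also have "\<delta> (concat mss) (\<delta> (map length mss) x \<otimes>\<^bsub>G (length (concat mss))\<^esub> B (map length mss) ys)
      = \<delta> (map sum_list mss) x \<otimes>\<^bsub>G ?N\<^esub> \<delta> (concat mss) (B (map length mss) ys)"
    using delta_mult[OF x' y' refl] delta_reindex_blocks[OF x ys] by simp
  also have "\<delta> (concat mss) (B (map length mss) ys) = B (map sum_list mss) ?d"
    using beta_delta[of ys mss] ys by (simp only: DirProd_map_carrier_iff)
  also have "B (concat mss) (concat zss) = B (map sum_list mss) ?b"
    using beta_assoc[of zss mss] zss by (simp add: listset_map_iff DirProd_map_carrier_iff)
  also have "\<delta> (map sum_list mss) x \<otimes>\<^bsub>G ?N\<^esub> B (map sum_list mss) ?d \<otimes>\<^bsub>G ?N\<^esub> B (map sum_list mss) ?b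
      = \<delta> (map sum_list mss) x \<otimes>\<^bsub>G ?N\<^esub> (B (map sum_list mss) ?d \<otimes>\<^bsub>G ?N\<^esub> B (map sum_list mss) ?b)"
    using dx beta_mem[OF d] beta_mem[OF b] by (intro mult_assoc) (simp_all only: N)
  also have "B (map sum_list mss) ?d \<otimes>\<^bsub>G ?N\<^esub> B (map sum_list mss) ?b
      = B (map sum_list mss) (map2 \<mu> mss (zip ys zss))"
    using beta_mult[OF d b] by (simp only: N db)
  also have "\<delta> (map sum_list mss) x \<otimes>\<^bsub>G ?N\<^esub> \<dots> = \<mu> (map sum_list mss) (x, map2 \<mu> mss (zip ys zss))"
    using comp_eq[of x "map sum_list mss" "map2 \<mu> mss (zip ys zss)"] x tuple_tuple_mult[OF d b]
    by (simp add: db N)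
  finally show ?thesis .
qed

lemma comp_interchange:
  assumes g: "g \<in> carrier (G (length ks))" and g': "g' \<in> carrier (G (length ks))"
    and fs: "tuple fs ks" and fs': "tuple fs' (reindex (inv' (\<pi> (length ks) g)) ks)"
  shows "\<mu> (reindex (inv' (\<pi> (length ks) g)) ks) (g', fs') \<otimes>\<^bsub>G (sum_list ks)\<^esub> \<mu> ks (g, fs)
    = \<mu> ks (g' \<otimes>\<^bsub>G (length ks)\<^esub> g, tuple_mult ks (reindex (\<pi> (length ks) g) fs') fs)"
proof -
  let ?p = "\<pi> (length ks) g" and ?N = "sum_list ks"
  define ks' where "ks' = reindex (inv' ?p) ks"
  \<comment> \<open>\<open>hs\<close> is \<open>fs'\<close> brought back to the arities
    \<open>ks\<close>; \<open>delta_beta\<close> for \<open>hs\<close> then moves \<beta> of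
    \<open>fs'\<close> past \<delta>(g).\<close>
  define hs where "hs = reindex ?p fs'"
  note p = proj_permutes[OF g]
  have N: "sum_list ks' = ?N"
    unfolding ks'_def using p by (intro sum_list_reindex permutes_inv)
  have n: "length ks' = length ks" by (simp add: ks'_def)
  have fs'': "tuple fs' ks'" using fs' by (simp add: ks'_def)
  have hs: "tuple hs ks" using fs' tuple_reindex_iff[OF p] by (simp add: hs_def)
  have "length fs' = length ks" using fs'' by (simp add: list_all2_conv_all_nth n)
  then have fs'_eq: "fs' = reindex (inv' ?p) hs" using p by (simp add: hs_def reindex_inv_cancel)
  have mem: "\<delta> ks' g' \<in> carrier (G ?N)" "B ks' fs' \<in> carrier (G ?N)"
    "\<delta> ks g \<in> carrier (G ?N)" "B ks fs \<in> carrier (G ?N)" "B ks hs \<in> carrier (G ?N)"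
    using delta_mem[of g' ks'] beta_mem[OF fs''] g g' fs hs by (simp_all add: n N)
  have "\<delta> ks g \<otimes>\<^bsub>G ?N\<^esub> B ks hs = B ks' fs' \<otimes>\<^bsub>G ?N\<^esub> \<delta> ks g"
    using delta_beta[of g ks hs] g hs by (simp add: DirProd_map_carrier_iff ks'_def fs'_eq)
  then have "(\<delta> ks' g' \<otimes>\<^bsub>G ?N\<^esub> B ks' fs') \<otimes>\<^bsub>G ?N\<^esub> (\<delta> ks g \<otimes>\<^bsub>G ?N\<^esub> B ks fs)
      = (\<delta> ks' g' \<otimes>\<^bsub>G ?N\<^esub> \<delta> ks g) \<otimes>\<^bsub>G ?N\<^esub> (B ks hs \<otimes>\<^bsub>G ?N\<^esub> B ks fs)"
    using mem by (metis mult_assoc mult_mem)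
  also have "\<delta> ks' g' \<otimes>\<^bsub>G ?N\<^esub> \<delta> ks g = \<delta> ks (g' \<otimes>\<^bsub>G (length ks)\<^esub> g)"
    by (rule delta_mult[OF g' g ks'_def])
  also have "B ks hs \<otimes>\<^bsub>G ?N\<^esub> B ks fs = B ks (tuple_mult ks hs fs)"
    by (rule beta_mult[OF hs fs])
  finally show ?thesis
    using comp_eq[of g' ks' fs'] comp_eq[OF g fs] g g' fs'' tuple_tuple_mult[OF hs fs]
    by (simp add: n N comp_eq flip: ks'_def hs_def)
qed

lemma action_operad: "action_operad G \<pi> \<one>\<^bsub>G 1\<^esub> \<mu>"
proof (intro action_operad.intro operad.intro action_operad_axioms.intro)
  show "group (G n)" "\<pi> n \<in> hom (G n) (sym_group n)" for n by (rule group proj_hom)+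
  show "\<one>\<^bsub>G 1\<^esub> \<in> carrier (G 1)" by simp
  show "\<mu> ks \<in> carrier (G (length ks)) \<times> listset (map (\<lambda>n. carrier (G n)) ks) \<rightarrow>\<^sub>E carrier (G (sum_list ks))"
    for ks
  proof (rule PiE_I)
    show "\<mu> ks z \<in> carrier (G (sum_list ks))"
      if "z \<in> carrier (G (length ks)) \<times> listset (map (\<lambda>n. carrier (G n)) ks)" for z
      using that by (auto simp: listset_map_iff comp_mem)
  qed (simp add: comp_of_def)
  \<comment> \<open>Here \<delta>(e_1) = e_n, and \<beta> of a single element is that
    element.\<close>
  show "\<mu> [n] (\<one>\<^bsub>G 1\<^esub>, [x]) = x" if "x \<in> carrier (G n)" for x n
    using that delta_one[of "[n]"] by (simp add: comp_eq beta_single)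
  show "\<mu> (replicate n 1) (x, replicate n \<one>\<^bsub>G 1\<^esub>) = x" if "x \<in> carrier (G n)" for x n
    using that beta_ones[of "replicate n 1"] tuple_ones[of "replicate n 1"] delta_ones[OF that]
    by (simp add: comp_eq sum_list_replicate)
  show "\<mu> (concat mss) (\<mu> (map length mss) (x, ys), concat zss)
      = \<mu> (map sum_list mss) (x, map2 \<mu> mss (zip ys zss))"
    if "x \<in> carrier (G (length mss))" "ys \<in> listset (map (\<lambda>n. carrier (G n)) (map length mss))"
      "zss \<in> listset (map (\<lambda>ms. listset (map (\<lambda>n. carrier (G n)) ms)) mss)" for x mss ys zss
    using that by (intro comp_assoc) (simp_all only: listset_map_iff)
  show "operad_map (\<lambda>n. carrier (G n)) \<one>\<^bsub>G 1\<^esub> \<mu> (\<lambda>n. carrier (sym_group n)) \<one>\<^bsub>sym_group 1\<^esub> sym_comp \<pi>"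
    unfolding operad_map_def
  proof (intro conjI allI impI)
    show "\<pi> n \<in> carrier (G n) \<rightarrow> carrier (sym_group n)" for n
      using proj_hom by (simp add: hom_def)
    show "\<pi> 1 \<one>\<^bsub>G 1\<^esub> = \<one>\<^bsub>sym_group 1\<^esub>" by (simp add: sym_group_one)
    fix ks x ys
    assume x: "x \<in> carrier (G (length ks))" and "ys \<in> listset (map (\<lambda>n. carrier (G n)) ks)"
    then have ys: "tuple ys ks" by (simp add: listset_map_iff)
    from x ys show "\<pi> (sum_list ks) (\<mu> ks (x, ys)) = sym_comp ks (\<pi> (length ks) x, map2 \<pi> ks ys)"
      using proj_permutes[OF x] tuple_proj[OF ys] proj_delta[OF x] proj_beta[of ys ks]
      by (simp add: comp_eq proj_mult sym_comp_def listset_map_iff sym_group_carrier sym_group_mult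
          DirProd_map_carrier_iff)
  qed
  show "\<mu> (reindex (inv' (\<pi> (length ks) g)) ks) (g', fs') \<otimes>\<^bsub>G (sum_list ks)\<^esub> \<mu> ks (g, fs)
      = \<mu> ks (g' \<otimes>\<^bsub>G (length ks)\<^esub> g, tuple_mult ks (reindex (\<pi> (length ks) g) fs') fs)"
    if "g \<in> carrier (G (length ks))" "g' \<in> carrier (G (length ks))"
      "fs \<in> listset (map (\<lambda>k. carrier (G k)) ks)"
      "fs' \<in> listset (map (\<lambda>k. carrier (G k)) (reindex (inv' (\<pi> (length ks) g)) ks))" for g ks g' fs fs'
    using that by (intro comp_interchange) (simp_all only: listset_map_iff)
qed

text \<open>On tuples, \<delta>(e) = e leaves \<beta>. Extensionality enters twice, over nonempty
  lists of arities and over the product group.\<close>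

lemma beta_of_comp: "beta_of G \<mu> = \<beta>"
proof (rule extensionalityI[of _ "{ks. ks \<noteq> []}"])
  fix ks :: "nat list" assume "ks \<in> {ks. ks \<noteq> []}"
  then have ks: "ks \<noteq> []" by simp
  show "beta_of G \<mu> ks = \<beta> ks"
  proof (rule extensionalityI[of _ "carrier (DirProd_list (map G ks))"])
    show "\<beta> ks \<in> extensional (carrier (DirProd_list (map G ks)))"
      using beta_hom ks by (auto simp: PiE_iff)
    show "beta_of G \<mu> ks \<in> extensional (carrier (DirProd_list (map G ks)))"
      using ks by (simp add: beta_of_def)
    fix hs assume "hs \<in> carrier (DirProd_list (map G ks))"
    then show "beta_of G \<mu> ks hs = \<beta> ks hs"
      using ks beta_mem[of hs ks]
      by (simp add: beta_of_def DirProd_map_carrier_iff comp_eq delta_one) (simp add: beta_ext_def)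
  qed
qed (use beta_hom in \<open>auto simp: beta_of_def PiE_iff\<close>)

text \<open>On the carrier, \<beta>(e, ..., e) = e leaves \<delta>; off it both are
  undefined.\<close>

lemma delta_of_comp: "delta_of G \<mu> = \<delta>"
proof
  fix ks
  show "delta_of G \<mu> ks = \<delta> ks"
    using delta_fun[of ks]
    by (intro extensionalityI[of _ "carrier (G (length ks))"])
      (auto simp: delta_of_def comp_eq tuple_ones beta_ones PiE_iff)
qed

end

theorem theorem4p15:
  shows "bij_betw (\<lambda>(G :: nat \<Rightarrow> 'a monoid, \<pi>, u, \<mu>). (G, \<pi>, beta_of G \<mu>, delta_of G \<mu>))
           {(G, \<pi>, u, \<mu>). action_operad G \<pi> u \<mu>}
           {(G, \<pi>, \<beta>, \<delta>). beta_delta_system G \<pi> \<beta> \<delta>}"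
\<comment> \<open>The inverse keeps the groups and projections and has no freedom in the unit:
  \<open>unit_eq_one\<close> forces it to be e_1.\<close>
proof (rule bij_betw_byWitness[where f' = "\<lambda>(G, \<pi>, \<beta>, \<delta>). (G, \<pi>, \<one>\<^bsub>G 1\<^esub>, comp_of G \<beta> \<delta>)"])
qed (auto simp: action_operad.comp_of_eq action_operad.unit_eq_one[symmetric] action_operad.system
      beta_delta_system.action_operad beta_delta_system.beta_of_comp beta_delta_system.delta_of_comp
      simp del: One_nat_def)

end
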